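(* Let $n\ge 1$. For a noncrossing partition $\pi$ of $[n]$ let $s(\pi)$ be its number of singleton blocks and $a(\pi)$ its number of adjacencies. Then: (1) On the set of noncrossing partitions of $[n]$ the statistics $s$ and $a$ have a symmetric joint distribution: for all integers $p,q\ge 0$, the number of noncrossing partitions $\pi$ of $[n]$ with $(s(\pi),a(\pi))=(p,q)$ equals the number with $(s(\pi),a(\pi))=(q,p)$. In particular $s$ and $a$ have the same distribution. (2) The same holds on the set of rotation classes of noncrossing partitions of $[n]$ (on which $s$ and $a$ are well defined, being constant on each rotation class): for all $p,q\ge 0$, the number of rotation classes with $(s,a)=(p,q)$ equals the number with $(s,a)=(q,p)$.
   Context: Write $[n]=\{1,2,\dots,n\}$. A partition of $[n]$ is noncrossing if no quadruple $a<b<c<d$ has $a,c$ in one block and $b,d$ in a different block. The rotation operator $R$ on partitions of $[n]$ is induced by the map $i\mapsto i+1\pmod n$ on $[n]$; it preserves the noncrossing property. The rotation class of $\pi$ is $\{R^i(\pi): i\ge 1\}$. An adjacency of $\pi$ is an occurrence of two consecutive elements of $[n]$ in the same block, where consecutive is taken in the circular sense ($n$ and $1$ are considered consecutive); that is, adjacencies are counted by the $i\in[n]$ such that $i$ and $i+1 \pmod n$ lie in the same block. (With this convention, for $n=1$ the unique partition has one adjacency, and for $n=2$ the one-block partition has two adjacencies.) *)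

theory Defs
  imports "HOL-Library.Disjoint_Sets"
begin

definition noncrossing :: "nat set set \<Rightarrow> bool" where
  "noncrossing P \<longleftrightarrow>
     \<not> (\<exists>A\<in>P. \<exists>B\<in>P. A \<noteq> B \<and>
          (\<exists>a b c d. a < b \<and> b < c \<and> c < d \<and> a \<in> A \<and> c \<in> A \<and> b \<in> B \<and> d \<in> B))"

definition NC :: "nat \<Rightarrow> nat set set set" where
  "NC n = {P. partition_on {1..n} P \<and> noncrossing P}"

(* The circular successor on {1..n}: n is sent to 1, every other i to i + 1. *)
definition cyc_succ :: "nat \<Rightarrow> nat \<Rightarrow> nat" where
  "cyc_succ n i = (if i = n then 1 else i + 1)"

definition rotation :: "nat \<Rightarrow> nat set set \<Rightarrow> nat set set" where
  "rotation n P = (\<lambda>B. cyc_succ n ` B) ` P"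

definition rotation_class :: "nat \<Rightarrow> nat set set \<Rightarrow> nat set set set" where
  "rotation_class n P = {(rotation n ^^ i) P | i. i \<ge> 1}"

definition NC_rotation_classes :: "nat \<Rightarrow> nat set set set set" where
  "NC_rotation_classes n = rotation_class n ` NC n"

definition singletons :: "nat set set \<Rightarrow> nat" where
  "singletons P = card {B \<in> P. card B = 1}"

definition adjacencies :: "nat \<Rightarrow> nat set set \<Rightarrow> nat" where
  "adjacencies n P = card {i \<in> {1..n}. \<exists>B\<in>P. i \<in> B \<and> cyc_succ n i \<in> B}"

(* The common value of a statistic f on a class C; meaningful only if f is constant on C. *)
definition class_stat :: "('a \<Rightarrow> nat) \<Rightarrow> 'a set \<Rightarrow> nat" where
  "class_stat f C = the_elem (f ` C)"

end

theory Submission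
  imports Defs
begin

text \<open>The Kreweras complement \<open>K\<close> puts \<open>i\<close> and \<open>j\<close> into the same block iff the
interval \<open>{i<..j}\<close> (or \<open>{j<..i}\<close>) is a union of blocks, so its point \<open>i\<close> stands for the
gap between \<open>i\<close> and \<open>i + 1\<close>. It turns singletons into adjacencies, and
its square is the inverse rotation on noncrossing partitions. Hence \<open>K\<close> permutes the noncrossing
partitions, commutes with the rotation and exchanges the two statistics, both on partitions and on
rotation classes.\<close>

section \<open>Partitions through their same-block relation\<close>

definition same_block :: "'a set set \<Rightarrow> 'a \<Rightarrow> 'a \<Rightarrow> bool" where
  "same_block P x y \<longleftrightarrow> (\<exists>B\<in>P. x \<in> B \<and> y \<in> B)"

text \<open>The trace of \<open>S\<close> on the ground set is a union of blocks; points of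
  \<open>S\<close> outside the ground set do not matter, since \<open>same_block\<close> never holds
  there.\<close>

definition saturated :: "'a set set \<Rightarrow> 'a set \<Rightarrow> bool" where
  "saturated P S \<longleftrightarrow> (\<forall>x y. same_block P x y \<longrightarrow> (x \<in> S \<longleftrightarrow> y \<in> S))"

text \<open>At least one of the two intervals is empty, so the union gives \<open>i\<close> and
  \<open>j\<close> symmetric roles without a case distinction.\<close>

definition krew_rel :: "nat \<Rightarrow> nat set set \<Rightarrow> (nat \<times> nat) set" where
  "krew_rel n P =
     {(i, j). i \<in> {1..n} \<and> j \<in> {1..n} \<and> saturated P ({i<..j} \<union> {j<..i})}"

definition krew :: "nat \<Rightarrow> nat set set \<Rightarrow> nat set set" where
  "krew n P = {1..n} // krew_rel n P"

lemma same_block_sym: "same_block P x y \<longleftrightarrow> same_block P y x"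
  by (auto simp: same_block_def)

lemma same_block_trans:
  assumes "partition_on A P" "same_block P x y" "same_block P y z"
  shows "same_block P x z"
proof -
  obtain B C where "B \<in> P" "x \<in> B" "y \<in> B" "C \<in> P" "y \<in> C" "z \<in> C"
    using assms(2,3) by (auto simp: same_block_def)
  moreover from this have "B = C"
    using disjointD[OF partition_onD2[OF assms(1)]] by blast
  ultimately show ?thesis by (auto simp: same_block_def)
qed

lemma same_block_refl: "partition_on A P \<Longrightarrow> x \<in> A \<Longrightarrow> same_block P x x"
  by (auto simp: same_block_def partition_on_def)

lemma same_block_in: "partition_on A P \<Longrightarrow> same_block P x y \<Longrightarrow> x \<in> A \<and> y \<in> A"
  by (auto simp: same_block_def partition_on_def)

lemma partition_on_eqI:
  assumes P: "partition_on A P" and Q: "partition_on A Q"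
    and eq: "\<And>x y. x \<in> A \<Longrightarrow> y \<in> A \<Longrightarrow> same_block P x y \<longleftrightarrow> same_block Q x y"
  shows "P = Q"
proof -
  have "{(x, y). same_block P x y} = {(x, y). same_block Q x y}"
    using eq same_block_in[OF P] same_block_in[OF Q] by blast
  moreover have "A // {(x, y). same_block P x y} = P" "A // {(x, y). same_block Q x y} = Q"
    unfolding same_block_def by (fact partition_on_eq_quotient[OF P] partition_on_eq_quotient[OF Q])+
  ultimately show ?thesis by metis
qed

lemma same_block_noncrossing:
  assumes "noncrossing P"
    and "same_block P a c" "same_block P b d" "a < b" "b < c" "c < d"
  shows "same_block P a b"
proof -
  obtain B C where "B \<in> P" "a \<in> B" "c \<in> B" "C \<in> P" "b \<in> C" "d \<in> C"
    using assms(2,3) by (auto simp: same_block_def)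
  moreover from this have "B = C"
    using assms(1,4-6) unfolding noncrossing_def by metis
  ultimately show ?thesis by (auto simp: same_block_def)
qed

lemma noncrossingI:
  assumes "partition_on A P"
    and "\<And>a b c d. same_block P a c \<Longrightarrow> same_block P b d \<Longrightarrow> a < b \<Longrightarrow> b < c \<Longrightarrow> c < d
      \<Longrightarrow> same_block P b c"
  shows "noncrossing P"
  unfolding noncrossing_def
proof clarify
  fix B C a b c d
  assume *: "B \<in> P" "C \<in> P" "B \<noteq> C" "a < b" "b < c" "c < d" "a \<in> B" "c \<in> B" "b \<in> C" "d \<in> C"
  then have "same_block P b c"
    using assms(2)[of a c b d] by (auto simp: same_block_def)
  then obtain D where "D \<in> P" "b \<in> D" "c \<in> D"
    by (auto simp: same_block_def)
  then show False
    using * partition_onD2[OF assms(1)] by (metis disjointD disjoint_iff)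
qed

section \<open>The Kreweras complement as a noncrossing partition\<close>

lemma saturated_Compl_interval:
  fixes P :: "nat set set"
  assumes "partition_on {1..n} P"
  shows "saturated P {x<..n} \<longleftrightarrow> saturated P {0<..x}"
proof -
  \<comment> \<open>Within \<open>{1..n}\<close> the two intervals are complementary, and
    complements of unions of blocks are unions of blocks. This is how the wrap-around from
    \<open>n\<close> to 1 is handled below.\<close>
  have "i \<in> {x<..n} \<longleftrightarrow> i \<notin> {0<..x}" if "i \<in> {1..n}" for i
    using that by auto
  then show ?thesis
    unfolding saturated_def using same_block_in[OF assms] by metis
qed

lemma krew_rel_equiv: "equiv {1..n} (krew_rel n P)"
proof (rule equivI)
  show "krew_rel n P \<subseteq> {1..n} \<times> {1..n}" by (auto simp: krew_rel_def)
  show "refl_on {1..n} (krew_rel n P)"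
    by (auto simp: refl_on_def krew_rel_def saturated_def)
  show "sym (krew_rel n P)"
    by (auto simp: sym_def krew_rel_def Un_commute)
  show "trans (krew_rel n P)"
  proof (rule transI)
    fix i j k assume *: "(i, j) \<in> krew_rel n P" "(j, k) \<in> krew_rel n P"
    \<comment> \<open>The interval between \<open>i\<close> and \<open>k\<close> is the symmetric
      difference of the other two, and unions of blocks are closed under symmetric
      difference.\<close>
    have "x \<in> {i<..k} \<union> {k<..i} \<longleftrightarrow>
        (x \<in> {i<..j} \<union> {j<..i}) \<noteq> (x \<in> {j<..k} \<union> {k<..j})" for x
      by auto
    with * show "(i, k) \<in> krew_rel n P"
      unfolding krew_rel_def saturated_def by (smt (verit) case_prodD case_prodI mem_Collect_eq)
  qed
qed

lemma krew_partition_on: "partition_on {1..n} (krew n P)"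
  unfolding krew_def by (rule partition_on_quotient[OF krew_rel_equiv])

lemma same_block_krew: "same_block (krew n P) i j \<longleftrightarrow> (i, j) \<in> krew_rel n P"
  unfolding same_block_def krew_def
  using krew_rel_equiv[of n P]
  by (smt (verit) equiv_class_eq_iff in_quotient_imp_closed quotientI quotient_eq_iff equiv_class_self)

lemma same_block_krew_less:
  "i < j \<Longrightarrow> same_block (krew n P) i j \<longleftrightarrow> 1 \<le> i \<and> j \<le> n \<and> saturated P {i<..j}"
  by (auto simp: same_block_krew krew_rel_def)

lemma krew_NC: "krew n P \<in> NC n"
proof -
  have "noncrossing (krew n P)"
  proof (rule noncrossingI[OF krew_partition_on])
    fix a b c d :: nat
    assume *: "same_block (krew n P) a c" "same_block (krew n P) b d" and lt: "a < b" "b < c" "c < d"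
    \<comment> \<open>Unions of blocks are closed under intersection.\<close>
    have "x \<in> {b<..c} \<longleftrightarrow> x \<in> {a<..c} \<and> x \<in> {b<..d}" for x
      using lt by auto
    then have "saturated P {b<..c}"
      using * lt by (auto simp: same_block_krew_less saturated_def)
    with * lt show "same_block (krew n P) b c"
      by (auto simp: same_block_krew_less)
  qed
  then show ?thesis
    using krew_partition_on by (simp add: NC_def)
qed

section \<open>Circular successor and rotation\<close>

lemma cyc_succ_in: "i \<in> {1..n} \<Longrightarrow> cyc_succ n i \<in> {1..n}"
  by (auto simp: cyc_succ_def)

lemma cyc_succ_inj: "inj_on (cyc_succ n) {1..n}"
  by (auto simp: inj_on_def cyc_succ_def split: if_splits)

lemma cyc_succ_bij: "bij_betw (cyc_succ n) {1..n} {1..n}"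
  using cyc_succ_inj cyc_succ_in
  by (metis bij_betw_def endo_inj_surj finite_atLeastAtMost image_subsetI)

lemma partition_on_rotation:
  assumes "partition_on {1..n} P" shows "partition_on {1..n} (rotation n P)"
proof -
  \<comment> \<open>\<open>partition_on_inj_image\<close> removes the empty set from the image; here
    there is none to remove.\<close>
  have "rotation n P = (`) (cyc_succ n) ` P - {{}}"
    using partition_onD3[OF assms] by (auto simp: rotation_def)
  with partition_on_inj_image[OF assms cyc_succ_inj] cyc_succ_bij[of n] show ?thesis
    by (simp add: bij_betw_def)
qed

lemma same_block_rotation:
  assumes "partition_on {1..n} P" "i \<in> {1..n}" "j \<in> {1..n}"
  shows "same_block (rotation n P) (cyc_succ n i) (cyc_succ n j) \<longleftrightarrow> same_block P i j"
proof -
  have "cyc_succ n x \<in> cyc_succ n ` B \<longleftrightarrow> x \<in> B" if "B \<in> P" "x \<in> {1..n}" for B x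
    using that assms(1) cyc_succ_inj[of n]
    by (metis Union_upper inj_on_image_mem_iff partition_on_def)
  with assms show ?thesis
    by (auto simp: same_block_def rotation_def)
qed

section \<open>Singletons and adjacencies under complement and rotation\<close>

lemma singletons_eq:
  assumes "partition_on A P"
  shows "singletons P = card {i \<in> A. \<forall>j. same_block P i j \<longrightarrow> j = i}"
proof -
  \<comment> \<open>Counting the points of singleton blocks instead of the blocks makes the
    statistic comparable with adjacencies, which count points.\<close>
  have "{B \<in> P. card B = 1} = (\<lambda>i. {i}) ` {i \<in> A. \<forall>j. same_block P i j \<longrightarrow> j = i}" (is "?L = ?R")
  proof (intro set_eqI iffI)
    fix B assume "B \<in> ?L"
    then obtain i where "B = {i}" "{i} \<in> P"
      by (auto simp: card_1_singleton_iff)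
    moreover from this have "i \<in> A" "\<forall>j. same_block P i j \<longrightarrow> j = i"
      using assms by (fastforce simp: same_block_def partition_on_def disjoint_def)+
    ultimately show "B \<in> ?R" by blast
  next
    fix B assume "B \<in> ?R"
    then obtain i where i: "B = {i}" "i \<in> A" "\<forall>j. same_block P i j \<longrightarrow> j = i"
      by auto
    then obtain C where C: "C \<in> P" "i \<in> C"
      using assms by (auto simp: partition_on_def)
    with i have "C = {i}"
      by (auto simp: same_block_def)
    with C i show "B \<in> ?L" by auto
  qed
  then show ?thesis
    unfolding singletons_def by (simp add: card_image)
qed

lemma adjacencies_eq: "adjacencies n P = card {i \<in> {1..n}. same_block P i (cyc_succ n i)}"
  by (simp add: adjacencies_def same_block_def)

text \<open>The interval between neighbours \<open>i\<close> and \<open>i + 1\<close> is the single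
  point \<open>i + 1\<close>, which is a union of blocks iff it forms a block alone. The wrap-around
  pair \<open>n\<close>, 1 reduces to the same fact by complementation.\<close>

lemma krew_adjacent:
  assumes P: "partition_on {1..n} P" and i: "i \<in> {1..n}"
  shows "same_block (krew n P) i (cyc_succ n i) \<longleftrightarrow>
    (\<forall>j. same_block P (cyc_succ n i) j \<longrightarrow> j = cyc_succ n i)"
proof -
  have single: "saturated P {k} \<longleftrightarrow> (\<forall>j. same_block P k j \<longrightarrow> j = k)" for k
    by (auto simp: saturated_def same_block_sym)
  show ?thesis
  proof (cases "i = n")
    case False
    with i have "{i<..cyc_succ n i} = {cyc_succ n i}" "i < cyc_succ n i" "cyc_succ n i \<le> n" "1 \<le> i"
      by (auto simp: cyc_succ_def)
    then show ?thesis by (simp add: same_block_krew_less single)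
  next
    case True
    then have s: "cyc_succ n n = 1" by (simp add: cyc_succ_def)
    have "saturated P {1<..n} \<longleftrightarrow> saturated P {0<..1}"
      by (rule saturated_Compl_interval[OF P])
    moreover have "{0<..1} = {1::nat}" by auto
    ultimately have "saturated P {1<..n} \<longleftrightarrow> saturated P {1}" by metis
    moreover have "same_block (krew n P) n 1 \<longleftrightarrow> saturated P {1<..n}"
      using i True by (auto simp: same_block_krew krew_rel_def)
    ultimately show ?thesis
      using single[of 1] unfolding True s by metis
  qed
qed

lemma adjacencies_krew:
  assumes P: "partition_on {1..n} P"
  shows "adjacencies n (krew n P) = singletons P"
proof -
  let ?S = "{i \<in> {1..n}. \<forall>j. same_block P i j \<longrightarrow> j = i}"
  \<comment> \<open>An adjacency of the complement at \<open>i\<close> comes from a singleton at the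
    successor of \<open>i\<close>; this shift preserves the count.\<close>
  have bij: "bij_betw (cyc_succ n) {i \<in> {1..n}. cyc_succ n i \<in> ?S} ?S"
  proof (rule bij_betw_imageI)
    show "inj_on (cyc_succ n) {i \<in> {1..n}. cyc_succ n i \<in> ?S}"
      by (rule inj_on_subset[OF cyc_succ_inj]) blast
    have "?S \<subseteq> cyc_succ n ` {1..n}"
      using cyc_succ_bij[of n] unfolding bij_betw_def by blast
    then show "cyc_succ n ` {i \<in> {1..n}. cyc_succ n i \<in> ?S} = ?S" by blast
  qed
  have eq: "{i \<in> {1..n}. same_block (krew n P) i (cyc_succ n i)} =
      {i \<in> {1..n}. cyc_succ n i \<in> ?S}"
    using krew_adjacent[OF P] cyc_succ_in by blast
  show ?thesis
    unfolding adjacencies_eq singletons_eq[OF P] eq by (rule bij_betw_same_card[OF bij])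
qed

lemma singletons_rotation:
  assumes P: "partition_on {1..n} P"
  shows "singletons (rotation n P) = singletons P"
proof -
  have sub: "\<And>B. B \<in> P \<Longrightarrow> B \<subseteq> {1..n}"
    using P by (auto simp: partition_on_def)
  have inj: "inj_on ((`) (cyc_succ n)) P"
    using sub cyc_succ_inj[of n] by (meson inj_onI inj_on_image_eq_iff)
  have "card (cyc_succ n ` B) = card B" if "B \<in> P" for B
    using sub[OF that] cyc_succ_inj[of n] by (meson card_image inj_on_subset)
  then have "{B \<in> rotation n P. card B = 1} = (`) (cyc_succ n) ` {B \<in> P. card B = 1}"
    by (auto simp: rotation_def)
  moreover have "inj_on ((`) (cyc_succ n)) {B \<in> P. card B = 1}"
    using inj by (rule inj_on_subset) auto
  ultimately show ?thesis
    unfolding singletons_def by (simp add: card_image)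
qed

section \<open>The square of the Kreweras complement\<close>

lemma saturated_gap:
  assumes P: "partition_on {1..n} P" and nc: "noncrossing P"
    and xy: "same_block P x y" "x < y"
    and gap: "\<And>z. same_block P x z \<Longrightarrow> \<not> (x < z \<and> z < y)"
  shows "saturated P {x<..y - 1}"
proof -
  have "v \<in> {x<..<y}" if "same_block P u v" "u \<in> {x<..<y}" for u v
  proof (rule ccontr)
    assume "v \<notin> {x<..<y}"
    \<comment> \<open>A link from \<open>u\<close> to a point beyond \<open>x\<close> or
      \<open>y\<close> would cross the pair \<open>x\<close>, \<open>y\<close>. So in every case
      \<open>u\<close> joins the block of \<open>x\<close>, against the choice of the gap.\<close>
    then consider "v < x" | "v = x" | "v = y" | "y < v" by fastforce
    then have "same_block P x u"
    proof cases
      case 1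
      then have "same_block P v x"
        using same_block_noncrossing[OF nc, of v u x y] that xy by (auto simp: same_block_sym)
      then show ?thesis using that by (metis same_block_sym same_block_trans[OF P])
    next
      case 4
      then show ?thesis
        using same_block_noncrossing[OF nc, of x y u v] that xy by auto
    qed (use that xy in \<open>metis same_block_sym same_block_trans[OF P]\<close>)+
    with gap[of u] that show False by auto
  qed
  moreover have "{x<..y - 1} = {x<..<y}" using xy by auto
  ultimately show ?thesis
    unfolding saturated_def by (metis same_block_sym)
qed

text \<open>Here \<open>x\<close> and \<open>y\<close> are the least and greatest elements of a
  block, and a link leaving their hull would cross that pair. The interval is written from
  \<open>x - 1\<close> to match the complement's arc from \<open>x - 1\<close> to \<open>y\<close>;
  as \<open>x\<close> is at least 1, the subtraction is exact.\<close>

lemma saturated_hull: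
  assumes P: "partition_on {1..n} P" and nc: "noncrossing P"
    and xy: "same_block P x y"
    and hull: "\<And>z. same_block P x z \<Longrightarrow> x \<le> z \<and> z \<le> y"
  shows "saturated P {x - 1<..y}"
proof -
  have "v \<in> {x..y}" if "same_block P u v" "u \<in> {x..y}" for u v
  proof (rule ccontr)
    assume v: "v \<notin> {x..y}"
    then have nxu: "\<not> same_block P x u"
      using hull that by (metis atLeastAtMost_iff same_block_trans[OF P])
    then have "u \<noteq> x" "u \<noteq> y"
      using xy same_block_refl[OF P] same_block_in[OF P xy] by auto
    with that have u: "x < u" "u < y" by auto
    consider "v < x" | "y < v" using v by fastforce
    then show False
    proof cases
      case 1
      then have "same_block P v x"
        using same_block_noncrossing[OF nc, of v u x y] that xy u by (auto simp: same_block_sym)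
      then show False using that nxu by (metis same_block_sym same_block_trans[OF P])
    next
      case 2
      then show False
        using same_block_noncrossing[OF nc, of x y u v] that xy u nxu by auto
    qed
  qed
  moreover have "{x - 1<..y} = {x..y}"
    using same_block_in[OF P xy] by auto
  ultimately show ?thesis
    unfolding saturated_def by (metis same_block_sym)
qed

text \<open>An arc of the complement leaving \<open>{i<..j}\<close> spans a union of blocks of
  \<open>P\<close> that separates the successors of \<open>i\<close> and \<open>j\<close>.
  Conversely, if these lie in different blocks, the block of \<open>i + 1\<close> has a gap or a
  hull that yields such an arc.\<close>

lemma saturated_krew_interval:
  assumes P: "partition_on {1..n} P" and nc: "noncrossing P"
    and ij: "1 \<le> i" "i < j" "j \<le> n"
  shows "saturated (krew n P) {i<..j} \<longleftrightarrow> same_block P (cyc_succ n i) (cyc_succ n j)"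
proof
  assume R: "same_block P (cyc_succ n i) (cyc_succ n j)"
  have si: "cyc_succ n i = i + 1" using ij by (simp add: cyc_succ_def)
  have "y \<in> {i<..j}" if xy: "same_block (krew n P) x y" and x: "x \<in> {i<..j}" for x y
  proof (rule ccontr)
    assume "y \<notin> {i<..j}"
    then consider "y \<le> i" | "y > j" by fastforce
    then show False
    proof cases
      case 1
      with xy x have "saturated P {y<..x}" "1 \<le> y"
        by (auto simp: same_block_sym[of _ x] same_block_krew_less)
      moreover from 1 x have "i + 1 \<in> {y<..x}" by auto
      \<comment> \<open>The successor of \<open>j\<close> is \<open>j + 1\<close>, beyond
        \<open>x\<close>, or 1, which is not above \<open>y\<close>.\<close>
      moreover from 1 x ij \<open>1 \<le> y\<close> have "cyc_succ n j \<notin> {y<..x}" by (auto simp: cyc_succ_def)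
      ultimately show False using R si unfolding saturated_def by metis
    next
      case 2
      with xy x have "saturated P {x<..y}" "y \<le> n"
        by (auto simp: same_block_krew_less)
      moreover from 2 x have "i + 1 \<notin> {x<..y}" by auto
      moreover from 2 x \<open>y \<le> n\<close> have "cyc_succ n j \<in> {x<..y}" by (auto simp: cyc_succ_def)
      ultimately show False using R si unfolding saturated_def by metis
    qed
  qed
  then show "saturated (krew n P) {i<..j}"
    unfolding saturated_def by (metis same_block_sym)
next
  assume L: "saturated (krew n P) {i<..j}"
  have si: "cyc_succ n i = i + 1" using ij by (simp add: cyc_succ_def)
  show "same_block P (cyc_succ n i) (cyc_succ n j)"
  proof (rule ccontr)
    assume "\<not> same_block P (cyc_succ n i) (cyc_succ n j)"
    then have no: "\<not> same_block P (i + 1) (cyc_succ n j)" by (simp add: si)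
    define B where "B = {z. same_block P (i + 1) z}"
    have Bn: "B \<subseteq> {1..n}" using same_block_in[OF P] by (auto simp: B_def)
    then have fin: "finite B" by (rule finite_subset) simp
    have iB: "i + 1 \<in> B" using same_block_refl[OF P] ij by (auto simp: B_def)
    have BB: "same_block P u v \<longleftrightarrow> v \<in> B" if "u \<in> B" for u v
      using that unfolding B_def mem_Collect_eq by (meson same_block_sym same_block_trans[OF P])
    \<comment> \<open>The last element of the block \<open>B\<close> of \<open>i + 1\<close> up to
      \<open>j\<close> is the inner end of the escaping arc; it exceeds \<open>i\<close> because
      \<open>i + 1\<close> is a candidate.\<close>
    define x where "x = Max (B \<inter> {..j})"
    have xB: "x \<in> B" "x \<le> j" and xmax: "\<And>z. z \<in> B \<Longrightarrow> z \<le> j \<Longrightarrow> z \<le> x"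
    proof -
      have "i + 1 \<in> B \<inter> {..j}" using iB ij by auto
      then have "x \<in> B \<inter> {..j}" unfolding x_def using fin by (intro Max_in) auto
      then show "x \<in> B" "x \<le> j" by auto
      show "z \<le> x" if "z \<in> B" "z \<le> j" for z unfolding x_def using fin that by simp
    qed
    have xi: "x \<in> {i<..j}" using xB xmax[of "i + 1"] iB ij by auto
    have out: "\<exists>y. y \<notin> {i<..j} \<and> same_block (krew n P) x y"
    proof (cases "\<exists>z\<in>B. z > j")
      case True
      \<comment> \<open>If \<open>B\<close> continues past \<open>j\<close>, its gap from
        \<open>x\<close> to the next element \<open>y\<close> gives the arc from \<open>x\<close> to
        \<open>y - 1\<close>. This end is still beyond \<open>j\<close>, since
        \<open>y = j + 1\<close> would put the successor of \<open>j\<close> into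
        \<open>B\<close>.\<close>
      define y where "y = Min (B \<inter> {j<..})"
      have yB: "y \<in> B" "y > j" and ymin: "\<And>z. z \<in> B \<Longrightarrow> z > j \<Longrightarrow> y \<le> z"
      proof -
        have "y \<in> B \<inter> {j<..}" unfolding y_def using fin True by (intro Min_in) auto
        then show "y \<in> B" "y > j" by auto
        show "y \<le> z" if "z \<in> B" "z > j" for z unfolding y_def using fin that by simp
      qed
      have "y \<noteq> j + 1"
      proof
        assume "y = j + 1"
        moreover from this have "cyc_succ n j = j + 1"
          using yB Bn by (auto simp: cyc_succ_def)
        ultimately show False using yB no by (auto simp: B_def)
      qed
      moreover have "saturated P {x<..y - 1}"
      proof (rule saturated_gap[OF P nc])
        show "same_block P x y" "x < y" using xB yB BB by auto
        show "\<not> (x < z \<and> z < y)" if "same_block P x z" for z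
          using that BB[OF xB(1)] xmax[of z] ymin[of z] by force
      qed
      ultimately have "y - 1 > j" "same_block (krew n P) x (y - 1)"
        using yB xi Bn ij by (auto simp: same_block_krew_less)
      then show ?thesis by (intro exI[of _ "y - 1"]) auto
    next
      case False
      \<comment> \<open>Otherwise \<open>B\<close> ends at \<open>x\<close>, and its hull gives an
        arc from \<open>m - 1\<close> to \<open>x\<close>, with \<open>m - 1\<close> at most
        \<open>i\<close>.\<close>
      define m where "m = Min B"
      have mB: "m \<in> B" and mmin: "\<And>z. z \<in> B \<Longrightarrow> m \<le> z"
      proof -
        show "m \<in> B" unfolding m_def using fin iB by (intro Min_in) auto
        show "m \<le> z" if "z \<in> B" for z unfolding m_def using fin that by simp
      qed
      have sat: "saturated P {m - 1<..x}"
      proof (rule saturated_hull[OF P nc])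
        show "same_block P m x" using mB xB BB by auto
        show "m \<le> z \<and> z \<le> x" if "same_block P m z" for z
          using that BB[OF mB] mmin[of z] xmax[of z] False by force
      qed
      show ?thesis
      proof (cases "m = 1")
        case True
        \<comment> \<open>Now \<open>m - 1 = 0\<close> is not a point, so the complementary interval
          supplies the arc from \<open>x\<close> to \<open>n\<close>. It escapes because
          \<open>j = n\<close> would make the successor of \<open>j\<close> equal to 1, an element
          of \<open>B\<close>.\<close>
        with no mB have "j < n" using ij by (cases "j = n") (auto simp: B_def cyc_succ_def)
        moreover have "saturated P {x<..n}"
          using sat True saturated_Compl_interval[OF P] by simp
        ultimately show ?thesis
          using xi by (intro exI[of _ n]) (auto simp: same_block_krew_less)
      next
        case False
        moreover have "1 \<le> m" "m \<le> i + 1" using mB Bn mmin[OF iB] by auto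
        ultimately show ?thesis
          using xi sat ij
          by (intro exI[of _ "m - 1"]) (auto simp: same_block_sym[of _ x] same_block_krew_less)
      qed
    qed
    with L xi show False by (auto simp: saturated_def)
  qed
qed

lemma same_block_krew_krew:
  assumes P: "P \<in> NC n" and ij: "i \<in> {1..n}" "j \<in> {1..n}"
  shows "same_block (krew n (krew n P)) i j \<longleftrightarrow> same_block P (cyc_succ n i) (cyc_succ n j)"
proof -
  have P': "partition_on {1..n} P" "noncrossing P" using P by (auto simp: NC_def)
  have less: "same_block (krew n (krew n P)) i j \<longleftrightarrow> same_block P (cyc_succ n i) (cyc_succ n j)"
    if "i < j" "i \<in> {1..n}" "j \<in> {1..n}" for i j
    using saturated_krew_interval[OF P', of i j] that by (simp add: same_block_krew_less)
  consider "i < j" | "j < i" | "i = j" by linarith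
  then show ?thesis
  proof cases
    case 3
    then show ?thesis
      using ij cyc_succ_in same_block_refl[OF P'(1)] same_block_refl[OF krew_partition_on] by metis
  qed (use less ij same_block_sym in metis)+
qed

lemma rotation_krew_krew:
  assumes P: "P \<in> NC n"
  shows "rotation n (krew n (krew n P)) = P"
proof (rule partition_on_eqI)
  show "partition_on {1..n} (rotation n (krew n (krew n P)))"
    by (rule partition_on_rotation[OF krew_partition_on])
  show "partition_on {1..n} P" using P by (simp add: NC_def)
  fix x y assume "x \<in> {1..n}" "y \<in> {1..n}"
  \<comment> \<open>Every point is a successor, so the relations can be compared on
    successors.\<close>
  then obtain i j where "x = cyc_succ n i" "y = cyc_succ n j" "i \<in> {1..n}" "j \<in> {1..n}"
    using cyc_succ_bij[of n] unfolding bij_betw_def by blast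
  then show "same_block (rotation n (krew n (krew n P))) x y \<longleftrightarrow> same_block P x y"
    using same_block_rotation[OF krew_partition_on] same_block_krew_krew[OF P] by simp
qed

section \<open>The complement as a permutation commuting with rotation\<close>

lemma finite_NC: "finite (NC n)"
  unfolding NC_def by (rule finite_subset[OF _ finitely_many_partition_on[of "{1..n}"]]) auto

text \<open>Rotation after a second complement is a left inverse, so \<open>krew n\<close> is
  injective on \<open>NC n\<close>; finiteness gives surjectivity.\<close>

lemma krew_bij: "bij_betw (krew n) (NC n) (NC n)"
proof -
  have "inj_on (krew n) (NC n)"
    by (rule inj_onI) (metis rotation_krew_krew)
  then show ?thesis
    using krew_NC finite_NC by (metis bij_betw_def endo_inj_surj image_subsetI)
qed

text \<open>On a partition written as a double complement, rotation just strips both complements.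
  Closure of \<open>NC n\<close> under rotation and commutation with \<open>krew n\<close> follow at
  once.\<close>

lemma NC_krew_krewE:
  assumes "P \<in> NC n"
  obtains Q where "Q \<in> NC n" "P = krew n (krew n Q)"
proof -
  have "P \<in> krew n ` krew n ` NC n"
    using assms krew_bij[of n] by (simp add: bij_betw_def)
  then show ?thesis using that by blast
qed

lemma rotation_NC: "P \<in> NC n \<Longrightarrow> rotation n P \<in> NC n"
  by (erule NC_krew_krewE) (simp add: rotation_krew_krew)

lemma rotation_krew: "P \<in> NC n \<Longrightarrow> rotation n (krew n P) = krew n (rotation n P)"
  by (erule NC_krew_krewE) (simp add: rotation_krew_krew krew_NC)

lemma singletons_rotation_NC: "P \<in> NC n \<Longrightarrow> singletons (rotation n P) = singletons P"
  by (simp add: NC_def singletons_rotation)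

lemma adjacencies_krew_NC: "P \<in> NC n \<Longrightarrow> adjacencies n (krew n P) = singletons P"
  by (simp add: NC_def adjacencies_krew)

text \<open>Adjacencies of \<open>krew n Q\<close> are singletons of \<open>Q\<close>, so invariance
  carries over from singletons.\<close>

lemma adjacencies_rotation:
  assumes "P \<in> NC n" shows "adjacencies n (rotation n P) = adjacencies n P"
proof -
  obtain Q where "Q \<in> NC n" "P = krew n Q"
    using assms krew_bij[of n] unfolding bij_betw_def by blast
  then show ?thesis
    by (simp add: rotation_krew adjacencies_krew_NC rotation_NC singletons_rotation_NC)
qed

text \<open>Singletons of \<open>krew n P\<close> are adjacencies of its complement, which is
  \<open>P\<close> up to rotation.\<close>

lemma singletons_krew:
  assumes "P \<in> NC n" shows "singletons (krew n P) = adjacencies n P"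
proof -
  have "singletons (krew n P) = adjacencies n (rotation n (krew n (krew n P)))"
    by (simp only: adjacencies_rotation[OF krew_NC] adjacencies_krew_NC[OF krew_NC])
  then show ?thesis by (simp only: rotation_krew_krew[OF assms])
qed

section \<open>Rotation classes and their statistics\<close>

lemma rotation_class_NC:
  assumes "P \<in> NC n" "Q \<in> rotation_class n P"
  shows "Q \<in> NC n" "singletons Q = singletons P" "adjacencies n Q = adjacencies n P"
proof -
  have "(rotation n ^^ i) P \<in> NC n \<and> singletons ((rotation n ^^ i) P) = singletons P \<and>
      adjacencies n ((rotation n ^^ i) P) = adjacencies n P" for i
    using assms(1)
    by (induction i) (auto simp: rotation_NC singletons_rotation_NC adjacencies_rotation)
  with assms(2) show "Q \<in> NC n" "singletons Q = singletons P" "adjacencies n Q = adjacencies n P"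
    by (auto simp: rotation_class_def)
qed

lemma class_stat_rotation_class:
  assumes "\<And>Q. Q \<in> rotation_class n P \<Longrightarrow> f Q = f P"
  shows "class_stat f (rotation_class n P) = f P"
proof -
  \<comment> \<open>The exponents start at 1, so this is the immediate witness that the class is
    nonempty, which \<open>the_elem\<close> requires.\<close>
  have "rotation n P \<in> rotation_class n P"
    unfolding rotation_class_def by (auto intro!: exI[of _ 1])
  with assms have "f ` rotation_class n P = {f P}" by force
  then show ?thesis by (simp add: class_stat_def)
qed

lemma krew_rotation_class:
  assumes "P \<in> NC n"
  shows "krew n ` rotation_class n P = rotation_class n (krew n P)"
proof -
  have "(rotation n ^^ i) P \<in> NC n \<and>
      krew n ((rotation n ^^ i) P) = (rotation n ^^ i) (krew n P)" for i
    using assms by (induction i) (simp_all add: rotation_NC rotation_krew[symmetric])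
  then show ?thesis
    unfolding rotation_class_def by (auto simp: setcompr_eq_image image_image)
qed

lemma krew_bij_classes:
  "bij_betw ((`) (krew n)) (NC_rotation_classes n) (NC_rotation_classes n)"
proof -
  \<comment> \<open>Taking images is injective on subsets of a set where the map is injective, and
    classes are subsets of \<open>NC n\<close>.\<close>
  have "inj_on ((`) (krew n)) (Pow (NC n))"
    using krew_bij[of n] by (simp add: bij_betw_def inj_on_image_Pow)
  moreover have "NC_rotation_classes n \<subseteq> Pow (NC n)"
    using rotation_class_NC(1) by (auto simp: NC_rotation_classes_def)
  ultimately have "inj_on ((`) (krew n)) (NC_rotation_classes n)"
    by (rule inj_on_subset)
  moreover have "(`) (krew n) ` NC_rotation_classes n = rotation_class n ` krew n ` NC n"
    unfolding NC_rotation_classes_def image_image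
    by (intro image_cong refl krew_rotation_class)
  ultimately show ?thesis
    using krew_bij[of n] by (simp add: bij_betw_def NC_rotation_classes_def)
qed

lemma class_stat_krew:
  assumes "C \<in> NC_rotation_classes n"
  shows "class_stat singletons (krew n ` C) = class_stat (adjacencies n) C"
    and "class_stat (adjacencies n) (krew n ` C) = class_stat singletons C"
proof -
  obtain P where P: "P \<in> NC n" "C = rotation_class n P"
    using assms by (auto simp: NC_rotation_classes_def)
  have "class_stat singletons (rotation_class n Q) = singletons Q"
    "class_stat (adjacencies n) (rotation_class n Q) = adjacencies n Q" if "Q \<in> NC n" for Q
    by (rule class_stat_rotation_class, erule rotation_class_NC[OF that])+
  with P show "class_stat singletons (krew n ` C) = class_stat (adjacencies n) C"
    "class_stat (adjacencies n) (krew n ` C) = class_stat singletons C"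
    by (simp_all add: krew_rotation_class krew_NC singletons_krew adjacencies_krew_NC)
qed

section \<open>Symmetry of the distributions\<close>

lemma card_Collect_bij:
  assumes "bij_betw f A A" "\<And>x. x \<in> A \<Longrightarrow> R (f x) \<longleftrightarrow> S x"
  shows "card {x \<in> A. S x} = card {x \<in> A. R x}"
proof -
  have "bij_betw f {x \<in> A. S x} {x \<in> A. R x}"
  proof (rule bij_betw_subset[OF assms(1)])
    have "{x \<in> f ` A. R x} = f ` {x \<in> A. S x}" using assms(2) by blast
    then show "f ` {x \<in> A. S x} = {x \<in> A. R x}" using assms(1) by (simp add: bij_betw_def)
  qed blast
  then show ?thesis by (rule bij_betw_same_card)
qed

theorem mainTheorem2:
  fixes n :: nat
  assumes "n \<ge> 1"
  shows
    "(\<forall>p q. card {P \<in> NC n. singletons P = p \<and> adjacencies n P = q}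
          = card {P \<in> NC n. singletons P = q \<and> adjacencies n P = p}) \<and>
     (\<forall>k. card {P \<in> NC n. singletons P = k} = card {P \<in> NC n. adjacencies n P = k}) \<and>
     (\<forall>C \<in> NC_rotation_classes n. \<forall>P \<in> C. \<forall>Q \<in> C.
        singletons P = singletons Q \<and> adjacencies n P = adjacencies n Q) \<and>
     (\<forall>p q. card {C \<in> NC_rotation_classes n.
                    class_stat singletons C = p \<and> class_stat (adjacencies n) C = q}
          = card {C \<in> NC_rotation_classes n.
                    class_stat singletons C = q \<and> class_stat (adjacencies n) C = p}) \<and>
     (\<forall>k. card {C \<in> NC_rotation_classes n. class_stat singletons C = k}
        = card {C \<in> NC_rotation_classes n. class_stat (adjacencies n) C = k})"
proof (intro conjI allI ballI)
  show "card {P \<in> NC n. singletons P = p \<and> adjacencies n P = q}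
      = card {P \<in> NC n. singletons P = q \<and> adjacencies n P = p}" for p q
    by (rule card_Collect_bij[OF krew_bij]) (auto simp: singletons_krew adjacencies_krew_NC)
  show "card {P \<in> NC n. singletons P = k} = card {P \<in> NC n. adjacencies n P = k}" for k
    by (rule card_Collect_bij[OF krew_bij]) (simp add: adjacencies_krew_NC)
  show "card {C \<in> NC_rotation_classes n.
            class_stat singletons C = p \<and> class_stat (adjacencies n) C = q}
      = card {C \<in> NC_rotation_classes n.
            class_stat singletons C = q \<and> class_stat (adjacencies n) C = p}" for p q
    by (rule card_Collect_bij[OF krew_bij_classes]) (auto simp: class_stat_krew)
  show "card {C \<in> NC_rotation_classes n. class_stat singletons C = k}
      = card {C \<in> NC_rotation_classes n. class_stat (adjacencies n) C = k}" for k
    by (rule card_Collect_bij[OF krew_bij_classes]) (simp add: class_stat_krew)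
  fix C P Q assume "C \<in> NC_rotation_classes n" "P \<in> C" "Q \<in> C"
  then show "singletons P = singletons Q" "adjacencies n P = adjacencies n Q"
    unfolding NC_rotation_classes_def using rotation_class_NC by fastforce+
qed

end
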